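(* Let $\theta\in(0,\pi]$. If $\cos\theta$ is not an algebraic number, then $\theta$ has the bipartite detection property.
   Context: A mixed graph $G=(V,\mathcal{A})$ consists of a finite vertex set $V$ and a set of arcs $\mathcal{A}\subseteq (V\times V)\setminus\{(x,x): x\in V\}$. Write $x\leftrightarrow y$ if $(x,y),(y,x)\in\mathcal A$, and $x\to y$ if $(x,y)\in\mathcal A$ but $(y,x)\notin\mathcal A$. The underlying graph $\Gamma(G)$ is the simple undirected graph on $V$ with edge $\{x,y\}$ whenever $(x,y)\in\mathcal A$ or $(y,x)\in\mathcal A$; $G$ is bipartite if $\Gamma(G)$ is bipartite. For $\theta\in(0,\pi]$, $H_\theta(G)\in\mathbb C^{V\times V}$ has $(x,y)$-entry $1$ if $x\leftrightarrow y$, $e^{i\theta}$ if $x\to y$, $e^{-i\theta}$ if $y\to x$, and $0$ otherwise. $G$ has the $\theta$-symmetric spectrum if the multiset of eigenvalues of $H_\theta(G)$ is invariant under $\lambda\mapsto-\lambda$ (with multiplicities). An angle $\theta$ has the bipartite detection property if for every mixed graph $G$: $G$ is bipartite iff $G$ has the $\theta$-symmetric spectrum. A complex number is algebraic if it is a root of a nonzero integer polynomial. *)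

theory Defs
  imports
    Complex_Main
    "Graph_Theory.Digraph_Component"
    "Jordan_Normal_Form.Char_Poly"
begin

text \<open>
  A mixed graph is a \<^typ>\<open>'v pair_pre_digraph\<close> satisfying \<^const>\<open>pair_digraph\<close>: finitely many
  vertices, arcs are pairs of vertices, no loops. A pair of opposite arcs is an undirected edge.
  Its underlying simple graph is \<^const>\<open>mk_symmetric\<close>, with each edge represented by both arcs.
\<close>

definition bipartite :: "'v pair_pre_digraph \<Rightarrow> bool" where
  "bipartite G \<longleftrightarrow>
     (\<exists>U W. pverts G = U \<union> W \<and> U \<inter> W = {} \<and>
        parcs (mk_symmetric (with_proj G)) \<subseteq> U \<times> W \<union> W \<times> U)"

definition hermitian_entry :: "real \<Rightarrow> 'v pair_pre_digraph \<Rightarrow> 'v \<Rightarrow> 'v \<Rightarrow> complex" where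
  "hermitian_entry \<theta> G x y =
     (if (x, y) \<in> parcs G \<and> (y, x) \<in> parcs G then 1
      else if (x, y) \<in> parcs G then cis \<theta>
      else if (y, x) \<in> parcs G then cis (- \<theta>)
      else 0)"

text \<open>
  Matrices in \<^typ>\<open>complex mat\<close> are indexed by natural numbers, so the vertices are listed in some
  fixed order. The order is arbitrary; a different one conjugates the matrix by a permutation
  matrix and leaves the spectrum unchanged.
\<close>

definition vertex_list :: "'v pair_pre_digraph \<Rightarrow> 'v list" where
  "vertex_list G = (SOME xs. distinct xs \<and> set xs = pverts G)"

definition hermitian_mat :: "real \<Rightarrow> 'v pair_pre_digraph \<Rightarrow> complex mat" where
  "hermitian_mat \<theta> G =
     mat (card (pverts G)) (card (pverts G))
       (\<lambda>(i, j). hermitian_entry \<theta> G (vertex_list G ! i) (vertex_list G ! j))"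

definition eigenvalues_mset :: "complex mat \<Rightarrow> complex multiset" where
  "eigenvalues_mset A = proots (char_poly A)"

definition symmetric_spectrum :: "real \<Rightarrow> 'v pair_pre_digraph \<Rightarrow> bool" where
  "symmetric_spectrum \<theta> G \<longleftrightarrow>
     image_mset uminus (eigenvalues_mset (hermitian_mat \<theta> G)) =
       eigenvalues_mset (hermitian_mat \<theta> G)"

text \<open>
  HOL formulas cannot quantify over types, so the vertex type is a parameter. A theorem stated for
  a type variable \<^typ>\<open>'v\<close> covers all mixed graphs; \<^typ>\<open>nat\<close> alone already represents every mixed
  graph up to isomorphism.
\<close>

definition bipartite_detection_property :: "'v itself \<Rightarrow> real \<Rightarrow> bool" where
  "bipartite_detection_property _ \<theta> \<longleftrightarrow>
     (\<forall>G :: 'v pair_pre_digraph. pair_digraph G \<longrightarrow> (bipartite G \<longleftrightarrow> symmetric_spectrum \<theta> G))"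

end

theory Submission
  imports Defs "Jordan_Normal_Form.Schur_Decomposition"
begin

text \<open>
  Write \<open>c = cos \<theta>\<close> and \<open>s = sin \<theta>\<close>. By induction on \<open>k\<close>, every entry of \<open>H\<^sub>\<theta>\<^sup>k\<close> has the
  form \<open>P(c) + i s Q(c)\<close> with integer polynomials \<open>P\<close>, \<open>Q\<close>, where \<open>P(1)\<close> is the number of
  walks of length \<open>k\<close> in the underlying graph, that is, the corresponding entry of \<open>H\<^sub>0\<^sup>k\<close>. If the
  spectrum is symmetric, then the trace of \<open>H\<^sub>\<theta>\<^sup>k\<close> vanishes for odd \<open>k\<close>; as \<open>c\<close> is transcendental,
  the polynomial \<open>P\<close> of the trace is zero, so \<open>P(1) = 0\<close> and there is no closed walk of odd length.
  Conversely, a bipartition yields a diagonal sign matrix that conjugates \<open>H\<^sub>\<theta>\<close> to \<open>-H\<^sub>\<theta>\<close>.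
\<close>

section \<open>Traces and eigenvalues\<close>

definition mat_trace :: "'a :: comm_monoid_add mat \<Rightarrow> 'a" where
  "mat_trace A = (\<Sum>i<dim_row A. A $$ (i, i))"

lemma mult_mat_entry:
  assumes "A \<in> carrier_mat n n" "B \<in> carrier_mat n n" "i < n" "j < n"
  shows "(A * B) $$ (i, j) = (\<Sum>k<n. A $$ (i, k) * B $$ (k, j))"
  using assms by (auto simp: scalar_prod_def lessThan_atLeast0)

lemma mat_trace_comm:
  fixes A B :: "'a :: comm_semiring_0 mat"
  assumes A: "A \<in> carrier_mat n n" and B: "B \<in> carrier_mat n n"
  shows "mat_trace (A * B) = mat_trace (B * A)"
proof -
  have "mat_trace (A * B) = (\<Sum>i<n. \<Sum>k<n. A $$ (i, k) * B $$ (k, i))"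
    using A B mult_mat_entry[OF A B] by (simp add: mat_trace_def)
  also have "\<dots> = (\<Sum>k<n. \<Sum>i<n. B $$ (k, i) * A $$ (i, k))"
    by (subst sum.swap) (simp add: mult.commute)
  also have "\<dots> = mat_trace (B * A)"
    using A B mult_mat_entry[OF B A] by (simp add: mat_trace_def)
  finally show ?thesis .
qed

lemma mat_trace_similar:
  fixes A B :: "'a :: comm_ring_1 mat"
  assumes "similar_mat_wit A B P Q"
  shows "mat_trace A = mat_trace B"
proof -
  define n where "n = dim_row A"
  note w = similar_mat_witD[OF n_def assms]
  have "mat_trace A = mat_trace ((P * B) * Q)" using w(3) by (rule arg_cong)
  also have "\<dots> = mat_trace (Q * (P * B))"
    using w(5-7) by (intro mat_trace_comm[of _ n]) auto
  also have "Q * (P * B) = (Q * P) * B"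
    using w(5-7) by (intro assoc_mult_mat[symmetric]) auto
  also have "\<dots> = B" using w(2,5) by simp
  finally show ?thesis .
qed

text \<open>The product \<open>A $$ (i, k) * B $$ (k, j)\<close> vanishes unless i \<le> k \<le> j.
  So no term survives below the diagonal, and only k = i survives on it.\<close>

lemma upper_triangular_mult:
  fixes A B :: "'a :: semiring_1 mat"
  assumes A: "A \<in> carrier_mat n n" and B: "B \<in> carrier_mat n n"
    and uA: "upper_triangular A" and uB: "upper_triangular B"
  shows "upper_triangular (A * B)"
    and "i < n \<Longrightarrow> (A * B) $$ (i, i) = A $$ (i, i) * B $$ (i, i)"
proof -
  have z: "A $$ (i, k) * B $$ (k, j) = 0" if "i < n" "j < n" "k < n" "k < i \<or> j < k" for i j k
    using that upper_triangularD[OF uA, of k i] upper_triangularD[OF uB, of j k] A B by auto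
  show "upper_triangular (A * B)"
  proof
    fix i j assume ij: "j < i" "i < dim_row (A * B)"
    then have "i < n" "j < n" using A by auto
    then show "(A * B) $$ (i, j) = 0"
      using z[of i j] ij(1) by (subst mult_mat_entry[OF A B]) (force intro!: sum.neutral)+
  qed
  assume i: "i < n"
  have "(A * B) $$ (i, i) = (\<Sum>k<n. if k = i then A $$ (i, i) * B $$ (i, i) else 0)"
    unfolding mult_mat_entry[OF A B i i] using z[of i i] i
    by (intro sum.cong) (auto simp: neq_iff)
  then show "(A * B) $$ (i, i) = A $$ (i, i) * B $$ (i, i)" using i by simp
qed

lemma upper_triangular_pow:
  fixes B :: "'a :: semiring_1 mat"
  assumes B: "B \<in> carrier_mat n n" and uB: "upper_triangular B"
  shows "upper_triangular (B ^\<^sub>m k) \<and> (\<forall>i<n. (B ^\<^sub>m k) $$ (i, i) = (B $$ (i, i)) ^ k)"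
proof (induction k)
  case 0
  then show ?case using B by auto
next
  case (Suc k)
  have C: "B ^\<^sub>m k \<in> carrier_mat n n" using B by (rule pow_carrier_mat)
  show ?case
    using Suc upper_triangular_mult[OF C B _ uB] by (auto simp: power_commutes)
qed

lemma eigenvalues_mset_upper_triangular:
  assumes "A \<in> carrier_mat n n" "upper_triangular A"
  shows "eigenvalues_mset A = mset (diag_mat A)"
proof -
  have "proots (\<Prod>a\<leftarrow>as. [:- a, 1:]) = mset as" for as :: "complex list"
  proof (induction as)
    case (Cons a as)
    \<comment> \<open>\<open>proots_mult\<close> requires both factors to be nonzero.\<close>
    have "(\<Prod>a\<leftarrow>as. [:- a, 1:]) \<noteq> 0"
      by (auto simp: prod_list_zero_iff)
    then show ?case using Cons by (simp add: proots_mult del: mult_pCons_left)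
  qed simp
  then show ?thesis
    unfolding eigenvalues_mset_def char_poly_upper_triangular[OF assms] .
qed

lemma eigenvalues_mset_similar:
  "similar_mat A B \<Longrightarrow> eigenvalues_mset A = eigenvalues_mset B"
  unfolding eigenvalues_mset_def by (simp add: char_poly_similar)

text \<open>Over the complex numbers the characteristic polynomial splits into linear factors, which
  is what Schur triangularization asks for.\<close>

lemma complex_schur:
  fixes A :: "complex mat"
  assumes A: "A \<in> carrier_mat n n"
  obtains B P Q where "B \<in> carrier_mat n n" "upper_triangular B" "similar_mat_wit A B P Q"
  using char_poly_factorized[OF A] schur_decomposition_exists[OF A]
  unfolding similar_mat_def by blast

text \<open>A similarity from A to a triangular B also takes -A to -B, so the eigenvalues with
  multiplicity can be compared on the two diagonals.\<close>

lemma eigenvalues_mset_uminus: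
  fixes A :: "complex mat"
  assumes A: "A \<in> carrier_mat n n"
  shows "eigenvalues_mset ((-1) \<cdot>\<^sub>m A) = image_mset uminus (eigenvalues_mset A)"
proof -
  obtain B P Q where B: "B \<in> carrier_mat n n" "upper_triangular B" "similar_mat_wit A B P Q"
    using complex_schur[OF A] .
  have sim: "similar_mat A B" using B(3) unfolding similar_mat_def by blast
  have C: "(-1) \<cdot>\<^sub>m B \<in> carrier_mat n n" using B(1) by simp
  have uC: "upper_triangular ((-1) \<cdot>\<^sub>m B)"
    using B(1,2) by (auto simp: upper_triangular_def)
  have "eigenvalues_mset ((-1) \<cdot>\<^sub>m A) = eigenvalues_mset ((-1) \<cdot>\<^sub>m B)"
    using similar_mat_wit_smult[OF B(3)] by (intro eigenvalues_mset_similar) (auto simp: similar_mat_def)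
  also have "\<dots> = mset (map uminus (diag_mat B))"
    unfolding eigenvalues_mset_upper_triangular[OF C uC]
    using B(1) by (auto simp: diag_mat_def simp del: mset_map intro!: arg_cong[of _ _ mset])
  also have "\<dots> = image_mset uminus (eigenvalues_mset A)"
    using eigenvalues_mset_upper_triangular[OF B(1,2)] eigenvalues_mset_similar[OF sim] by simp
  finally show ?thesis .
qed

text \<open>Powers preserve similarity to the Schur form B, and raising the triangular B to the
  power k raises each diagonal entry to the power k.\<close>

lemma mat_trace_pow:
  fixes A :: "complex mat"
  assumes A: "A \<in> carrier_mat n n"
  shows "mat_trace (A ^\<^sub>m k) = (\<Sum>x\<in>#eigenvalues_mset A. x ^ k)"
proof -
  obtain B P Q where B: "B \<in> carrier_mat n n" "upper_triangular B" "similar_mat_wit A B P Q"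
    using complex_schur[OF A] .
  have sim: "similar_mat A B" using B(3) unfolding similar_mat_def by blast
  have "mat_trace (A ^\<^sub>m k) = mat_trace (B ^\<^sub>m k)"
    by (rule mat_trace_similar[OF similar_mat_wit_pow[OF B(3)]])
  also have "\<dots> = (\<Sum>i<n. (B $$ (i, i)) ^ k)"
    using upper_triangular_pow[OF B(1,2)] B(1) by (simp add: mat_trace_def)
  also have "\<dots> = (\<Sum>x\<leftarrow>diag_mat B. x ^ k)"
    using B(1) by (simp add: diag_mat_def o_def interv_sum_list_conv_sum_set_nat lessThan_atLeast0)
  also have "\<dots> = (\<Sum>x\<in>#mset (diag_mat B). x ^ k)"
    by (simp flip: sum_mset_sum_list)
  also have "mset (diag_mat B) = eigenvalues_mset A"
    using eigenvalues_mset_upper_triangular[OF B(1,2)] eigenvalues_mset_similar[OF sim] by simp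
  finally show ?thesis .
qed

lemma sum_mset_uminus: "(\<Sum>x\<in>#M. - f x) = - (\<Sum>x\<in>#M. f x :: 'a :: ab_group_add)"
  by (induction M) auto

text \<open>Negating the eigenvalues negates their odd power sums, so symmetry makes such a sum
  equal to its own negative.\<close>

lemma mat_trace_odd_pow_eq_0:
  fixes A :: "complex mat"
  assumes A: "A \<in> carrier_mat n n"
    and sym: "image_mset uminus (eigenvalues_mset A) = eigenvalues_mset A" and k: "odd k"
  shows "mat_trace (A ^\<^sub>m k) = 0"
proof -
  let ?M = "eigenvalues_mset A"
  have "(\<Sum>x\<in>#?M. x ^ k) = (\<Sum>x\<in>#image_mset uminus ?M. x ^ k)" using sym by simp
  also have "\<dots> = (\<Sum>x\<in>#?M. - (x ^ k))"
    using k by (simp add: image_mset.compositionality o_def)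
  also have "\<dots> = - (\<Sum>x\<in>#?M. x ^ k)" by (rule sum_mset_uminus)
  finally have "2 * (\<Sum>x\<in>#?M. x ^ k) = 0"
    by (simp only: eq_neg_iff_add_eq_0 mult_2)
  then show ?thesis unfolding mat_trace_pow[OF A] mult_eq_0_iff by simp
qed

section \<open>Integer polynomials in the cosine\<close>

text \<open>The integer \<open>a\<close> is the value at angle 0 of a formal expression whose value
  at \<theta> is \<open>z\<close>. It is a relation because \<open>z\<close> need not determine
  \<open>a\<close> when \<open>cos \<theta>\<close> is algebraic.\<close>

definition cos_poly_rep :: "real \<Rightarrow> complex \<Rightarrow> int \<Rightarrow> bool" where
  "cos_poly_rep \<theta> z a \<longleftrightarrow>
     (\<exists>P Q. z = Complex (poly (of_int_poly P) (cos \<theta>)) (sin \<theta> * poly (of_int_poly Q) (cos \<theta>)) \<and>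
        poly P 1 = a)"

lemma cos_poly_repI:
  assumes "Re z = poly (of_int_poly P) (cos \<theta>)" "Im z = sin \<theta> * poly (of_int_poly Q) (cos \<theta>)"
    and "poly P 1 = a"
  shows "cos_poly_rep \<theta> z a"
  using assms unfolding cos_poly_rep_def complex_eq_iff by auto

lemma cos_poly_repE:
  assumes "cos_poly_rep \<theta> z a"
  obtains P Q where "Re z = poly (of_int_poly P) (cos \<theta>)"
    "Im z = sin \<theta> * poly (of_int_poly Q) (cos \<theta>)" "poly P 1 = a"
  using assms unfolding cos_poly_rep_def complex_eq_iff by auto

lemma cos_poly_rep_0: "cos_poly_rep \<theta> 0 0"
  by (rule cos_poly_repI[of _ 0 _ 0]) simp_all

lemma cos_poly_rep_1: "cos_poly_rep \<theta> 1 1"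
  by (rule cos_poly_repI[of _ 1 _ 0]) simp_all

lemma cos_poly_rep_cis: "cos_poly_rep \<theta> (cis \<theta>) 1"
  by (rule cos_poly_repI[of _ "[:0, 1:]" _ 1]) simp_all

lemma cos_poly_rep_cis_uminus: "cos_poly_rep \<theta> (cis (- \<theta>)) 1"
  by (rule cos_poly_repI[of _ "[:0, 1:]" _ "[:- 1:]"]) simp_all

lemma cos_poly_rep_add:
  assumes "cos_poly_rep \<theta> z a" "cos_poly_rep \<theta> w b"
  shows "cos_poly_rep \<theta> (z + w) (a + b)"
proof -
  from assms(1) obtain P Q where zPQ: "Re z = poly (of_int_poly P) (cos \<theta>)"
    "Im z = sin \<theta> * poly (of_int_poly Q) (cos \<theta>)" "poly P 1 = a" by (rule cos_poly_repE)
  from assms(2) obtain P' Q' where wPQ: "Re w = poly (of_int_poly P') (cos \<theta>)"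
    "Im w = sin \<theta> * poly (of_int_poly Q') (cos \<theta>)" "poly P' 1 = b" by (rule cos_poly_repE)
  show ?thesis
    by (rule cos_poly_repI[of _ "P + P'" _ "Q + Q'"])
       (simp_all add: zPQ wPQ of_int_poly_hom.hom_add distrib_left)
qed

text \<open>The product of the two sine terms contributes the square of the sine to the real part.
  This is the polynomial \<open>S\<close> in the cosine; as \<open>S\<close> vanishes at 1, the
  values at 1 simply multiply.\<close>

lemma cos_poly_rep_mult:
  assumes "cos_poly_rep \<theta> z a" "cos_poly_rep \<theta> w b"
  shows "cos_poly_rep \<theta> (z * w) (a * b)"
proof -
  from assms(1) obtain P Q where zPQ: "Re z = poly (of_int_poly P) (cos \<theta>)"
    "Im z = sin \<theta> * poly (of_int_poly Q) (cos \<theta>)" "poly P 1 = a" by (rule cos_poly_repE)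
  from assms(2) obtain P' Q' where wPQ: "Re w = poly (of_int_poly P') (cos \<theta>)"
    "Im w = sin \<theta> * poly (of_int_poly Q') (cos \<theta>)" "poly P' 1 = b" by (rule cos_poly_repE)
  define S :: "int poly" where "S = [:1, 0, -1:]"
  have S: "poly (of_int_poly S) (cos \<theta>) = sin \<theta> * sin \<theta>"
    using sin_cos_squared_add[of \<theta>] by (simp add: S_def power2_eq_square)
  have S1: "poly S 1 = 0" by (simp add: S_def)
  show ?thesis
    by (rule cos_poly_repI[of _ "P * P' - S * (Q * Q')" _ "P * Q' + Q * P'"])
       (simp_all add: zPQ wPQ S S1 of_int_poly_hom.hom_add of_int_poly_hom.hom_minus
          of_int_poly_hom.hom_mult algebra_simps)
qed

lemma cos_poly_rep_sum:
  "(\<And>i. i \<in> A \<Longrightarrow> cos_poly_rep \<theta> (f i) (g i)) \<Longrightarrow> cos_poly_rep \<theta> (sum f A) (sum g A)"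
  by (induction A rule: infinite_finite_induct) (auto intro: cos_poly_rep_0 cos_poly_rep_add)

text \<open>Transcendence enters here: the real part gives an integer polynomial with root
  \<open>cos \<theta>\<close>, which must then be the zero polynomial.\<close>

lemma cos_poly_rep_zero_imp:
  assumes "cos_poly_rep \<theta> 0 a" and "\<not> algebraic (cos \<theta>)"
  shows "a = 0"
proof -
  obtain P :: "int poly" where P: "poly (of_int_poly P) (cos \<theta>) = 0" "poly P 1 = a"
    using assms(1) by (auto elim: cos_poly_repE)
  have "P = 0"
  proof (rule ccontr)
    assume "P \<noteq> 0"
    then have "algebraic (cos \<theta>)"
      using P(1) by (intro algebraicI[of "of_int_poly P"]) auto
    with assms(2) show False by simp
  qed
  then show ?thesis using P(2) by simp
qed

text \<open>Entries of powers are built from the original entries by sums and products, both of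
  which respect \<open>cos_poly_rep\<close>.\<close>

lemma cos_poly_rep_pow_mat:
  assumes A: "A \<in> carrier_mat n n" and B: "B \<in> carrier_mat n n"
    and rep: "\<And>i j. i < n \<Longrightarrow> j < n \<Longrightarrow> cos_poly_rep \<theta> (A $$ (i, j)) (B $$ (i, j))"
  shows "i < n \<Longrightarrow> j < n \<Longrightarrow> cos_poly_rep \<theta> ((A ^\<^sub>m k) $$ (i, j)) ((B ^\<^sub>m k) $$ (i, j))"
proof (induction k arbitrary: i j)
  case 0
  then show ?case using A B by (auto intro: cos_poly_rep_0 cos_poly_rep_1)
next
  case (Suc k)
  have C: "A ^\<^sub>m k \<in> carrier_mat n n" "B ^\<^sub>m k \<in> carrier_mat n n"
    using A B by (auto intro: pow_carrier_mat)
  show ?case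
    unfolding pow_mat.simps mult_mat_entry[OF C(1) A Suc.prems] mult_mat_entry[OF C(2) B Suc.prems]
    using Suc by (auto intro!: cos_poly_rep_sum cos_poly_rep_mult rep)
qed

section \<open>Walks and bipartiteness\<close>

lemma parcs_underlying:
  "(x, y) \<in> parcs (mk_symmetric (with_proj G)) \<longleftrightarrow> (x, y) \<in> parcs G \<or> (y, x) \<in> parcs G"
  unfolding parcs_mk_symmetric by (auto intro: bexI[of _ "(y, x)"])

text \<open>An entry of the power sums the weights of all index walks of length k. Nonnegativity
  rules out cancellation, so a single walk along \<open>E\<close> makes the entry positive.\<close>

lemma pow_mat_walk:
  fixes B :: "int mat"
  assumes B: "B \<in> carrier_mat n n"
    and nonneg: "\<And>i j. i < n \<Longrightarrow> j < n \<Longrightarrow> 0 \<le> B $$ (i, j)"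
    and pos: "\<And>i j. i < n \<Longrightarrow> j < n \<Longrightarrow> (v i, v j) \<in> E \<Longrightarrow> 0 < B $$ (i, j)"
    and E: "E \<subseteq> v ` {..<n} \<times> v ` {..<n}" and inj: "inj_on v {..<n}"
  shows "i < n \<Longrightarrow> j < n \<Longrightarrow>
    0 \<le> (B ^\<^sub>m k) $$ (i, j) \<and> ((v i, v j) \<in> E ^^ k \<longrightarrow> 0 < (B ^\<^sub>m k) $$ (i, j))"
proof (induction k arbitrary: i j)
  case 0
  \<comment> \<open>A walk of length 0 gives v i = v j; injectivity then places the entry on the
    diagonal of the identity matrix.\<close>
  then show ?case using B inj by (auto dest: inj_onD)
next
  case (Suc k)
  have C: "B ^\<^sub>m k \<in> carrier_mat n n" using B by (rule pow_carrier_mat)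
  have eq: "(B ^\<^sub>m Suc k) $$ (i, j) = (\<Sum>l<n. (B ^\<^sub>m k) $$ (i, l) * B $$ (l, j))"
    using mult_mat_entry[OF C B Suc.prems] by simp
  have nn: "0 \<le> (B ^\<^sub>m k) $$ (i, l) * B $$ (l, j)" if "l < n" for l
    using Suc nonneg that by simp
  have "0 < (B ^\<^sub>m Suc k) $$ (i, j)" if walk: "(v i, v j) \<in> E ^^ Suc k"
  proof -
    obtain y where y: "(v i, y) \<in> E ^^ k" "(y, v j) \<in> E" using walk by auto
    then obtain l where l: "l < n" "y = v l" using E by auto
    then have "0 < (B ^\<^sub>m k) $$ (i, l) * B $$ (l, j)"
      using Suc y pos by simp
    then show ?thesis unfolding eq using l nn by (intro sum_pos2[of _ l]) auto
  qed
  moreover have "0 \<le> (B ^\<^sub>m Suc k) $$ (i, j)"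
    unfolding eq using nn by (intro sum_nonneg) auto
  ultimately show ?case by blast
qed

lemma relpow_sym:
  assumes "sym R"
  shows "(x, y) \<in> R ^^ k \<Longrightarrow> (y, x) \<in> R ^^ k"
proof (induction k arbitrary: y)
  case (Suc k)
  then show ?case using symD[OF assms] by (blast elim: relpow_Suc_E intro: relpow_Suc_I2)
qed simp

text \<open>Each point is coloured by the parity of a walk from a chosen root of its component.
  Walks of different parity to the same point would combine, one of them reversed, into a closed odd
  walk at the root.\<close>

lemma two_colouring:
  assumes sym: "sym E" and no_odd: "\<And>x k. odd k \<Longrightarrow> (x, x) \<notin> E ^^ k"
  obtains U where "\<And>x y. (x, y) \<in> E \<Longrightarrow> x \<in> U \<longleftrightarrow> y \<notin> U"
proof
  define root where "root x = (SOME r. (r, x) \<in> E\<^sup>*)" for x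
  define U where "U = {x. \<exists>k. even k \<and> (root x, x) \<in> E ^^ k}"
  fix x y assume xy: "(x, y) \<in> E"
  \<comment> \<open>The choice in \<open>root\<close> depends only on the set of points that reach
    its argument, so neighbours receive the same root.\<close>
  have "(r, x) \<in> E\<^sup>* \<longleftrightarrow> (r, y) \<in> E\<^sup>*" for r
    using xy symD[OF sym xy] by (meson rtrancl.rtrancl_into_rtrancl)
  then have root_eq: "root y = root x" by (simp add: root_def)
  have "(root x, x) \<in> E\<^sup>*" unfolding root_def by (rule someI[of _ x]) simp
  then obtain k where k: "(root x, x) \<in> E ^^ k" by (auto dest: rtrancl_imp_relpow)
  have parity: "even a = even b" if "(r, z) \<in> E ^^ a" "(r, z) \<in> E ^^ b" for r z a b
    using no_odd[of "a + b" r] relpow_trans[OF that(1) relpow_sym[OF sym that(2)]] by auto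
  have k': "(root y, y) \<in> E ^^ Suc k" using k xy root_eq by auto
  have "x \<in> U \<longleftrightarrow> even k" unfolding U_def using parity[OF k] k by blast
  moreover have "y \<in> U \<longleftrightarrow> even (Suc k)" unfolding U_def using parity[OF k'] k' by blast
  ultimately show "x \<in> U \<longleftrightarrow> y \<notin> U" by simp
qed

section \<open>The two implications for a fixed mixed graph\<close>

context pair_digraph
begin

lemma vertex_list: "distinct (vertex_list G)" "set (vertex_list G) = pverts G"
proof -
  have "\<exists>xs. distinct xs \<and> set xs = pverts G"
    using finite_distinct_list[OF pair_finite_verts] by blast
  from someI_ex[OF this] show "distinct (vertex_list G)" "set (vertex_list G) = pverts G"
    unfolding vertex_list_def by auto
qed

lemma length_vertex_list: "length (vertex_list G) = card (pverts G)"
  using vertex_list distinct_card by fastforce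

lemma hermitian_mat_carrier: "hermitian_mat \<theta> G \<in> carrier_mat (card (pverts G)) (card (pverts G))"
  by (simp add: hermitian_mat_def)

lemma underlying_subset: "parcs (mk_symmetric (with_proj G)) \<subseteq> pverts G \<times> pverts G"
  using arc_fst_in_verts arc_snd_in_verts by (force simp: parcs_underlying)

lemma bipartite_imp_symmetric_spectrum:
  assumes "bipartite G"
  shows "symmetric_spectrum \<theta> G"
proof -
  obtain U W where UW: "U \<inter> W = {}"
    "parcs (mk_symmetric (with_proj G)) \<subseteq> U \<times> W \<union> W \<times> U"
    using assms unfolding bipartite_def by blast
  define n where "n = card (pverts G)"
  define H where "H = hermitian_mat \<theta> G"
  define s :: "nat \<Rightarrow> complex" where "s i = (if vertex_list G ! i \<in> U then 1 else - 1)" for i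
  define D where "D = mat_diag n s"
  have H: "H \<in> carrier_mat n n" unfolding H_def n_def by (rule hermitian_mat_carrier)
  have D: "D \<in> carrier_mat n n" by (simp add: D_def)
  have ss: "s i * s i = 1" for i by (simp add: s_def)
  \<comment> \<open>The sign matrix is its own inverse, so \<open>D * H * D\<close> is similar to
    \<open>H\<close>.\<close>
  have DD: "D * D = 1\<^sub>m n"
    by (rule eq_matI) (auto simp: D_def mat_diag_diag ss)
  have ent: "s i * H $$ (i, j) * s j = - H $$ (i, j)" if "i < n" "j < n" for i j
  proof -
    let ?x = "vertex_list G ! i" and ?y = "vertex_list G ! j"
    have "H $$ (i, j) = 0" if "(?x, ?y) \<notin> parcs (mk_symmetric (with_proj G))"
      using that \<open>i < n\<close> \<open>j < n\<close>
      by (simp add: H_def n_def hermitian_mat_def hermitian_entry_def parcs_underlying)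
    moreover have "s i * s j = - 1" if "(?x, ?y) \<in> parcs (mk_symmetric (with_proj G))"
      using that UW by (auto simp: s_def)
    moreover have "s i * H $$ (i, j) * s j = (s i * s j) * H $$ (i, j)" by (simp only: ac_simps)
    ultimately show ?thesis
      by (cases "(?x, ?y) \<in> parcs (mk_symmetric (with_proj G))") auto
  qed
  have "D * H * D = (-1) \<cdot>\<^sub>m H"
  proof (rule eq_matI)
    fix i j assume "i < dim_row ((-1) \<cdot>\<^sub>m H)" "j < dim_col ((-1) \<cdot>\<^sub>m H)"
    then have ij: "i < n" "j < n" using H by auto
    have "D * H * D = mat n n (\<lambda>(i, j). s i * H $$ (i, j) * s j)"
      unfolding D_def mat_diag_mult_left[OF H]
      by (subst mat_diag_mult_right[of _ n]) (auto intro!: eq_matI)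
    then show "(D * H * D) $$ (i, j) = ((-1) \<cdot>\<^sub>m H) $$ (i, j)"
      using ij H ent by simp
  qed (use H D in auto)
  then have "similar_mat ((-1) \<cdot>\<^sub>m H) H"
    using H D DD by (intro similar_matI[of _ _ D D n]) auto
  then show ?thesis
    using eigenvalues_mset_similar eigenvalues_mset_uminus[OF H]
    by (metis H_def symmetric_spectrum_def)
qed

lemma symmetric_spectrum_imp_bipartite:
  assumes spec: "symmetric_spectrum \<theta> G" and transc: "\<not> algebraic (cos \<theta>)"
  shows "bipartite G"
proof -
  define n where "n = card (pverts G)"
  define H where "H = hermitian_mat \<theta> G"
  define E where "E = parcs (mk_symmetric (with_proj G))"
  define v where "v i = vertex_list G ! i" for i
  \<comment> \<open>The adjacency matrix of the underlying graph supplies the integer companions of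
    the entries of \<open>H\<close>: each nonzero entry has companion 1.\<close>
  define B :: "int mat" where "B = mat n n (\<lambda>(i, j). of_bool ((v i, v j) \<in> E))"
  have H: "H \<in> carrier_mat n n" unfolding H_def n_def by (rule hermitian_mat_carrier)
  have B: "B \<in> carrier_mat n n" by (simp add: B_def)
  have verts: "v ` {..<n} = pverts G"
    using vertex_list(2) length_vertex_list by (auto simp: v_def n_def set_conv_nth image_iff)
  have inj: "inj_on v {..<n}"
    using vertex_list(1) length_vertex_list by (auto simp: v_def n_def inj_on_def nth_eq_iff_index_eq)
  have E: "E \<subseteq> v ` {..<n} \<times> v ` {..<n}" unfolding verts E_def by (rule underlying_subset)
  have rep: "cos_poly_rep \<theta> (H $$ (i, j)) (B $$ (i, j))" if "i < n" "j < n" for i j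
    using that
    by (auto simp: H_def B_def E_def n_def v_def hermitian_mat_def hermitian_entry_def parcs_underlying
        intro: cos_poly_rep_0 cos_poly_rep_1 cos_poly_rep_cis cos_poly_rep_cis_uminus)
  have walk: "0 \<le> (B ^\<^sub>m k) $$ (i, j) \<and> ((v i, v j) \<in> E ^^ k \<longrightarrow> 0 < (B ^\<^sub>m k) $$ (i, j))"
    if "i < n" "j < n" for i j k
    by (rule pow_mat_walk[OF B _ _ E inj that]) (auto simp: B_def)
  have "(x, x) \<notin> E ^^ k" if k: "odd k" for x k
  proof
    assume x: "(x, x) \<in> E ^^ k"
    \<comment> \<open>An odd walk has a first arc, so \<open>x\<close> is a vertex of the graph and
      has an index in the matrix.\<close>
    with k obtain y where "(x, y) \<in> E" by (cases k) (use relpow_Suc_D2[of x x] in auto)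
    then obtain i where i: "i < n" "x = v i" using E by auto
    have "cos_poly_rep \<theta> (mat_trace (H ^\<^sub>m k)) (mat_trace (B ^\<^sub>m k))"
      using H B cos_poly_rep_pow_mat[OF H B rep] by (auto simp: mat_trace_def intro!: cos_poly_rep_sum)
    moreover have "mat_trace (H ^\<^sub>m k) = 0"
      using mat_trace_odd_pow_eq_0[OF H _ k] spec by (simp add: symmetric_spectrum_def H_def)
    ultimately have "mat_trace (B ^\<^sub>m k) = 0"
      using cos_poly_rep_zero_imp transc by simp
    \<comment> \<open>All diagonal entries are nonnegative, and the closed walk at \<open>x\<close>
      makes the one at \<open>i\<close> positive.\<close>
    moreover have "0 < mat_trace (B ^\<^sub>m k)"
      using walk i x B by (auto simp: mat_trace_def intro!: sum_pos2[of _ i])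
    ultimately show False by simp
  qed
  moreover have "sym E" by (auto simp: sym_def E_def parcs_underlying)
  ultimately obtain U where U: "\<And>x y. (x, y) \<in> E \<Longrightarrow> x \<in> U \<longleftrightarrow> y \<notin> U"
    using two_colouring[of E] by metis
  \<comment> \<open>The colouring lives on the whole vertex type, so it is cut down to the vertices
    of the graph.\<close>
  have "E \<subseteq> (pverts G \<inter> U) \<times> (pverts G - U) \<union> (pverts G - U) \<times> (pverts G \<inter> U)"
    using U E verts by blast
  then show ?thesis
    unfolding bipartite_def E_def
    by - (rule exI[of _ "pverts G \<inter> U"], rule exI[of _ "pverts G - U"], auto)
qed

end

theorem theorem4p2:
  fixes \<theta> :: real
  assumes "0 < \<theta>" and "\<theta> \<le> pi"
    and "\<not> algebraic (cos \<theta>)"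
  shows "bipartite_detection_property TYPE('v) \<theta>"
  unfolding bipartite_detection_property_def
  using pair_digraph.bipartite_imp_symmetric_spectrum
    pair_digraph.symmetric_spectrum_imp_bipartite[OF _ _ assms(3)] by blast

end
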